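(* For every positive integer $\ell$ there exists a graph $G$ having a spanning tree $T$ such that $\gamma_g(G)-\gamma_g(T)\ge \ell$.
   Context: Graphs are finite, simple and nonempty. A spanning tree of $G$ is a subgraph of $G$ that is a tree and has the same vertex set as $G$. For a vertex $v$, $N[v]$ is its closed neighborhood; a chosen vertex $v$ dominates all vertices of $N[v]$. The domination game on a graph $G$ is played by two players, Dominator and Staller, who alternately choose vertices of $G$; each chosen vertex must dominate at least one vertex that was not dominated by the previously chosen vertices. The game ends when all vertices of $G$ are dominated. Dominator wants the total number of chosen vertices to be as small as possible, Staller wants it to be as large as possible. The game domination number $\gamma_g(G)$ is the total number of vertices chosen (by both players) when Dominator makes the first move and both players play optimally. *)

theory Defs
  imports "Graph_Theory.Graph_Theory"
begin

text \<open>
  Undirected simple graphs are the symmetric loopless digraphs given by \<^locale>\<open>pair_graph\<close>: an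
  undirected edge is a pair of opposite arcs. This locale gives finiteness, but not nonemptiness.

  The constants \<^const>\<open>tree\<close> and \<^const>\<open>spanning_tree\<close> are unsuitable for such graphs, because
  \<^const>\<open>forest\<close> already excludes the directed 2-cycle formed by a single undirected edge. The
  cycles of an undirected simple graph are the directed cycles of length at least 3. Nonemptiness
  is part of \<^const>\<open>connected\<close>.
\<close>

definition undirected_tree :: "'a pair_pre_digraph \<Rightarrow> bool" where
  "undirected_tree T \<longleftrightarrow>
     pair_graph T \<and> connected (with_proj T) \<and>
     \<not> (\<exists>p. pre_digraph.cycle (with_proj T) p \<and> 3 \<le> length p)"

definition undirected_spanning_tree ::
  "'a pair_pre_digraph \<Rightarrow> 'a pair_pre_digraph \<Rightarrow> bool" where
  "undirected_spanning_tree T G \<longleftrightarrow>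
     undirected_tree T \<and> spanning (with_proj T) (with_proj G)"

definition closed_nbhd :: "'a pair_pre_digraph \<Rightarrow> 'a \<Rightarrow> 'a set" where
  "closed_nbhd G v = insert v {u. (v, u) \<in> parcs G}"

definition dominated :: "'a pair_pre_digraph \<Rightarrow> 'a set \<Rightarrow> 'a set" where
  "dominated G S = (\<Union>u\<in>S. closed_nbhd G u)"

definition legal_moves :: "'a pair_pre_digraph \<Rightarrow> 'a set \<Rightarrow> 'a set" where
  "legal_moves G S = {v \<in> pverts G. \<not> closed_nbhd G v \<subseteq> dominated G S}"

datatype player = Dominator | Staller

text \<open>
  The value \<open>game_value G P S\<close> is the number of moves still to be made under optimal play when the
  vertices in \<open>S\<close> have been chosen and player \<open>P\<close> is to move. The finiteness test only serves
  termination. The sets under \<^const>\<open>Min\<close> and \<^const>\<open>Max\<close> are nonempty, since an undominated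
  vertex is itself a legal move.
\<close>

function game_value :: "'a pair_pre_digraph \<Rightarrow> player \<Rightarrow> 'a set \<Rightarrow> nat" where
  "game_value G P S =
     (if infinite (pverts G) \<or> pverts G \<subseteq> dominated G S then 0
      else case P of
        Dominator \<Rightarrow> Suc (Min ((\<lambda>v. game_value G Staller (insert v S)) ` legal_moves G S))
      | Staller \<Rightarrow> Suc (Max ((\<lambda>v. game_value G Dominator (insert v S)) ` legal_moves G S)))"
  by pat_completeness auto
termination
proof (relation "measure (\<lambda>(G, P, S). card (pverts G - S))")
  have *: "card (pverts G - insert v S) < card (pverts G - S)"
    if "finite (pverts G)" "v \<in> legal_moves G S" for G :: "'a pair_pre_digraph" and v S
  proof (rule psubset_card_mono)
    have "v \<in> pverts G" "v \<notin> S"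
      using that(2) by (auto simp: legal_moves_def dominated_def)
    then show "pverts G - insert v S \<subset> pverts G - S" by auto
  qed (use that in simp)
  show "((G, Staller, insert v S), G, P, S) \<in> measure (\<lambda>(G, P, S). card (pverts G - S))"
    if "\<not> (infinite (pverts G) \<or> pverts G \<subseteq> dominated G S)" "P = Dominator"
      "v \<in> legal_moves G S" for G :: "'a pair_pre_digraph" and P S v
    using * that by simp
  show "((G, Dominator, insert v S), G, P, S) \<in> measure (\<lambda>(G, P, S). card (pverts G - S))"
    if "\<not> (infinite (pverts G) \<or> pverts G \<subseteq> dominated G S)" "P = Staller"
      "v \<in> legal_moves G S" for G :: "'a pair_pre_digraph" and P S v
    using * that by simp
qed simp

declare game_value.simps [simp del]

definition game_domination_number :: "'a pair_pre_digraph \<Rightarrow> nat" where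
  "game_domination_number G = game_value G Dominator {}"

end

theory Submission
  imports Defs
begin

text \<open>
  The tree \<open>T\<close> is a spider: a hub with \<open>k\<close> legs \<open>o - a - b - c - d\<close> attached by \<open>o\<close>, together with \<open>k\<close>
  leaves \<open>w\<close>. The graph \<open>G\<close> has in addition an edge between \<open>b\<close> and \<open>w\<close> for each leg. On \<open>T\<close>,
  Dominator starts at the hub, which leaves the paths \<open>a - b - c - d\<close> undominated and makes the
  leaves useless. Each further move of Staller can be answered so that a path is finished by exactly
  two moves, so the game takes at most \<open>2 k + 1\<close> moves. On \<open>G\<close>, a leg needs two moves to dominate
  \<open>a\<close> and \<open>d\<close>, and while \<open>b\<close> is undominated Staller can play \<open>w\<close>, which dominates neither. Staller
  does so in at least half of the legs, which makes \<open>5 k / 2\<close> moves.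
\<close>

section \<open>Bounds on the game value\<close>

lemma dominated_insert: "dominated G (insert v S) = closed_nbhd G v \<union> dominated G S"
  by (simp add: dominated_def)

lemma finite_legal_moves: "finite (pverts G) \<Longrightarrow> finite (legal_moves G S)"
  by (simp add: legal_moves_def)

lemma legal_moves_ne: "\<not> pverts G \<subseteq> dominated G S \<Longrightarrow> legal_moves G S \<noteq> {}"
  by (auto simp: legal_moves_def closed_nbhd_def)

lemma game_value_dominated: "pverts G \<subseteq> dominated G S \<Longrightarrow> game_value G P S = 0"
  by (simp add: game_value.simps)

lemma game_value_Dominator:
  "finite (pverts G) \<Longrightarrow> \<not> pverts G \<subseteq> dominated G S \<Longrightarrow>
    game_value G Dominator S =
      Suc (Min ((\<lambda>v. game_value G Staller (insert v S)) ` legal_moves G S))"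
  by (subst game_value.simps) simp

lemma game_value_Staller:
  "finite (pverts G) \<Longrightarrow> \<not> pverts G \<subseteq> dominated G S \<Longrightarrow>
    game_value G Staller S =
      Suc (Max ((\<lambda>v. game_value G Dominator (insert v S)) ` legal_moves G S))"
  by (subst game_value.simps) simp

lemma game_value_Dominator_le:
  assumes "finite (pverts G)" "v \<in> legal_moves G S"
  shows "game_value G Dominator S \<le> Suc (game_value G Staller (insert v S))"
\<comment> \<open>For an arbitrary \<open>G\<close> a closed neighbourhood may leave
  \<open>pverts G\<close>, so a legal move can exist in a finished game; the value is then
  0.\<close>
proof (cases "pverts G \<subseteq> dominated G S")
  case False
  then show ?thesis
    using assms by (simp add: game_value_Dominator finite_legal_moves)
qed (simp add: game_value_dominated)

lemma game_value_Staller_ge: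
  assumes "finite (pverts G)" "\<not> pverts G \<subseteq> dominated G S" "v \<in> legal_moves G S"
  shows "Suc (game_value G Dominator (insert v S)) \<le> game_value G Staller S"
  using assms by (simp add: game_value_Staller finite_legal_moves)

lemma game_value_Dominator_ge:
  assumes "finite (pverts G)" "\<not> pverts G \<subseteq> dominated G S"
    and "\<And>v. v \<in> legal_moves G S \<Longrightarrow> n \<le> Suc (game_value G Staller (insert v S))"
  shows "n \<le> game_value G Dominator S"
proof -
  have "Min ((\<lambda>v. game_value G Staller (insert v S)) ` legal_moves G S)
      \<in> (\<lambda>v. game_value G Staller (insert v S)) ` legal_moves G S"
    using assms by (intro Min_in) (auto simp: finite_legal_moves legal_moves_ne)
  then show ?thesis
    using assms by (auto simp: game_value_Dominator)
qed

lemma game_value_Staller_le: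
  assumes "finite (pverts G)" "\<not> pverts G \<subseteq> dominated G S"
    and "\<And>v. v \<in> legal_moves G S \<Longrightarrow> Suc (game_value G Dominator (insert v S)) \<le> n"
  shows "game_value G Staller S \<le> n"
proof -
  have "Max ((\<lambda>v. game_value G Dominator (insert v S)) ` legal_moves G S)
      \<in> (\<lambda>v. game_value G Dominator (insert v S)) ` legal_moves G S"
    using assms by (intro Max_in) (auto simp: finite_legal_moves legal_moves_ne)
  then show ?thesis
    using assms by (auto simp: game_value_Staller)
qed

section \<open>Strategies of Staller and of Dominator\<close>

lemma card_undominated_le:
  assumes "finite X" "card (X \<inter> closed_nbhd G v) \<le> 1"
  shows "card (X - dominated G S) \<le> Suc (card (X - dominated G (insert v S)))"
proof -
  have "card (X - dominated G S) \<le>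
      card ((X - dominated G (insert v S)) \<union> (X \<inter> closed_nbhd G v))"
    using assms(1) by (intro card_mono) (auto simp: dominated_insert)
  then show ?thesis
    using assms(2) card_Un_le[of "X - dominated G (insert v S)" "X \<inter> closed_nbhd G v"] by linarith
qed

text \<open>
  Every move dominates at most one vertex of \<open>X\<close>, and Staller wastes moves that dominate none as
  long as some vertex of \<open>B\<close> is undominated. Dominator can only spoil one of these wasted moves at
  a time, so Staller gets at least half of them.
\<close>
lemma game_value_ge_packing:
  assumes "finite (pverts G)" "X \<subseteq> pverts G" "B \<subseteq> pverts G"
    and "\<And>v. card (X \<inter> closed_nbhd G v) \<le> 1" "\<And>v. card (B \<inter> closed_nbhd G v) \<le> 1"
    and "\<And>b. b \<in> B \<Longrightarrow> \<exists>w\<in>pverts G. b \<in> closed_nbhd G w \<and> X \<inter> closed_nbhd G w = {}"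
  shows "card (X - dominated G S) +
      (card (B - dominated G S) + (if P = Staller then 1 else 0)) div 2 \<le> game_value G P S"
  using assms
proof (induction G P S rule: game_value.induct)
  case (1 G P S)
  let ?x = "\<lambda>S. card (X - dominated G S)" and ?b = "\<lambda>S. card (B - dominated G S)"
  note hyps = "1.prems"
  have fin: "finite X" "finite B"
    using hyps(1-3) finite_subset by auto
  have x_le: "?x S \<le> Suc (?x (insert v S))" and b_le: "?b S \<le> Suc (?b (insert v S))" for v
    using hyps(4,5) fin by (blast intro: card_undominated_le)+
  show ?case
  proof (cases "pverts G \<subseteq> dominated G S")
    case True
    then have "X - dominated G S = {}" "B - dominated G S = {}"
      using hyps(2,3) by auto
    then show ?thesis
      by (simp only: card.empty) simp
  next
    case False
    then have ongoing: "\<not> (infinite (pverts G) \<or> pverts G \<subseteq> dominated G S)"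
      using hyps(1) by simp
    show ?thesis
    proof (cases P)
      case Dominator
      \<comment> \<open>Dominator may lower both counts by one. The extra 1 on Staller's turn makes
        up for the loss in \<open>B\<close>: (b - 1 + 1) div 2 = b div 2.\<close>
      have "?x S + ?b S div 2 \<le> game_value G Dominator S"
      proof (rule game_value_Dominator_ge[OF hyps(1) False])
        fix v assume "v \<in> legal_moves G S"
        then have "?x (insert v S) + (?b (insert v S) + 1) div 2 \<le>
            game_value G Staller (insert v S)"
          using "1.IH"(1)[OF ongoing Dominator _ hyps] by simp
        then show "?x S + ?b S div 2 \<le> Suc (game_value G Staller (insert v S))"
          using x_le[of v] b_le[of v] by linarith
      qed
      then show ?thesis
        using Dominator by simp
    next
      case Staller
      have IH: "?x (insert v S) + ?b (insert v S) div 2 \<le> game_value G Dominator (insert v S)"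
        if "v \<in> legal_moves G S" for v
        using "1.IH"(2)[OF ongoing Staller that hyps] by simp
      \<comment> \<open>Staller wastes a move on a vertex of \<open>B\<close> while one is
        undominated; afterwards any legal move will do, as the halved term is then 1 div 2 =
        0.\<close>
      obtain v where v: "v \<in> legal_moves G S"
        "?x S + (?b S + 1) div 2 \<le> Suc (?x (insert v S) + ?b (insert v S) div 2)"
      proof (cases "B \<subseteq> dominated G S")
        case True
        obtain v where "v \<in> legal_moves G S"
          using legal_moves_ne[OF False] by auto
        moreover have "?b S = 0"
          using True by (simp add: Diff_eq_empty_iff[THEN iffD2])
        ultimately show ?thesis
          using x_le[of v] by (intro that[of v]) simp_all
      next
        case nonempty: False
        then obtain b where b: "b \<in> B" "b \<notin> dominated G S"
          by auto
        then obtain w where w: "w \<in> pverts G" "b \<in> closed_nbhd G w" "X \<inter> closed_nbhd G w = {}"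
          using hyps(6) by blast
        have "X - dominated G (insert w S) = X - dominated G S"
          using w(3) by (auto simp: dominated_insert)
        moreover have "w \<in> legal_moves G S"
          using b w by (auto simp: legal_moves_def)
        ultimately show ?thesis
          using b_le[of w] by (intro that[of w]) simp_all
      qed
      have "?x S + (?b S + 1) div 2 \<le> game_value G Staller S"
        using v(2) IH[OF v(1)] game_value_Staller_ge[OF hyps(1) False v(1)] by linarith
      then show ?thesis
        using Staller by simp
    qed
  qed
qed

text \<open>No closed neighbourhood meets two of the sets \<open>C i\<close>, so Staller's move
  touches just one of them, and Dominator's reply finishes it. As Staller's move never finishes it
  alone, the reply is legal, and each \<open>i\<close> costs exactly two moves.\<close>

lemma game_value_le_paired_replies:
  assumes fin: "finite (pverts G)" and F: "finite F"
    and undom: "pverts G - dominated G S = (\<Union>i\<in>F. C i)"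
    and sub: "\<And>v. v \<in> pverts G \<Longrightarrow> closed_nbhd G v \<subseteq> pverts G"
    and one: "\<And>v x y i j. x \<in> closed_nbhd G v \<inter> C i \<Longrightarrow> y \<in> closed_nbhd G v \<inter> C j \<Longrightarrow> i = j"
    and reply: "\<And>v i. i \<in> F \<Longrightarrow> v \<in> pverts G \<Longrightarrow> closed_nbhd G v \<inter> C i \<noteq> {} \<Longrightarrow>
      \<exists>r\<in>pverts G. C i \<subseteq> closed_nbhd G v \<union> closed_nbhd G r \<and> \<not> C i \<subseteq> closed_nbhd G v"
  shows "game_value G Staller S \<le> 2 * card F"
  using F undom reply
proof (induction F arbitrary: S rule: finite_psubset_induct)
  case (psubset F S)
  show ?case
  proof (cases "pverts G \<subseteq> dominated G S")
    case False
    show ?thesis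
    proof (rule game_value_Staller_le[OF fin False])
      fix v assume "v \<in> legal_moves G S"
      then have v: "v \<in> pverts G" "\<not> closed_nbhd G v \<subseteq> dominated G S"
        by (auto simp: legal_moves_def)
      then have "closed_nbhd G v \<inter> (\<Union>i\<in>F. C i) \<noteq> {}"
        using sub[OF v(1)] psubset.prems(1) by blast
      then obtain i where i: "i \<in> F" "closed_nbhd G v \<inter> C i \<noteq> {}"
        by blast
      then obtain r where r: "r \<in> pverts G" "C i \<subseteq> closed_nbhd G v \<union> closed_nbhd G r"
          "\<not> C i \<subseteq> closed_nbhd G v"
        using psubset.prems(2) v(1) by meson
      \<comment> \<open>The vertex \<open>x\<close> makes the reply \<open>r\<close> legal and shows
        that \<open>r\<close>, like \<open>v\<close>, touches no set other than
        \<open>C i\<close>.\<close>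
      then obtain x where x: "x \<in> C i" "x \<notin> closed_nbhd G v" "x \<in> closed_nbhd G r"
        by blast
      have x_undom: "x \<notin> dominated G (insert v S)"
        using x i(1) psubset.prems(1) by (auto simp: dominated_insert)
      have disj: "(closed_nbhd G v \<union> closed_nbhd G r) \<inter> C j = {}" if "j \<noteq> i" for j
        using one i(2) x that by blast
      have "pverts G - dominated G (insert r (insert v S)) =
          (\<Union>j\<in>F. C j) - (closed_nbhd G v \<union> closed_nbhd G r)"
        unfolding psubset.prems(1)[symmetric] dominated_insert by blast
      also have "\<dots> = (\<Union>j\<in>F - {i}. C j)"
      proof
        show "(\<Union>j\<in>F. C j) - (closed_nbhd G v \<union> closed_nbhd G r) \<subseteq> (\<Union>j\<in>F - {i}. C j)"
          using r(2) by blast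
        show "(\<Union>j\<in>F - {i}. C j) \<subseteq> (\<Union>j\<in>F. C j) - (closed_nbhd G v \<union> closed_nbhd G r)"
          using disj by fastforce
      qed
      finally have "pverts G - dominated G (insert r (insert v S)) = (\<Union>j\<in>F - {i}. C j)" .
      then have "game_value G Staller (insert r (insert v S)) \<le> 2 * card (F - {i})"
        using i(1) by (intro psubset.IH psubset.prems(2)) auto
      moreover have "r \<in> legal_moves G (insert v S)"
        using r(1) x(3) x_undom by (auto simp: legal_moves_def)
      ultimately have "game_value G Dominator (insert v S) \<le> Suc (2 * card (F - {i}))"
        using game_value_Dominator_le[OF fin] by (meson Suc_le_mono order_trans)
      then show "Suc (game_value G Dominator (insert v S)) \<le> 2 * card F"
        using card_Suc_Diff1[OF psubset.hyps(1) i(1)] by linarith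
    qed
  qed (simp add: game_value_dominated)
qed

section \<open>Trees given by a parent function\<close>

text \<open>The root is 0. When \<open>p v < v\<close> for all positive \<open>v\<close>, each
  vertex has at most one smaller neighbour and descending along parents ends at 0; acyclicity and
  connectedness rest on this.\<close>

definition parent_graph :: "nat \<Rightarrow> (nat \<Rightarrow> nat) \<Rightarrow> nat pair_pre_digraph" where
  "parent_graph n p =
     \<lparr>pverts = {..n}, parcs = {(u, v). u \<le> n \<and> v \<le> n \<and> (0 < u \<and> v = p u \<or> 0 < v \<and> u = p v)}\<rparr>"

lemma pair_graphI:
  assumes "finite V" "E \<subseteq> V \<times> V" "sym E" "irrefl E"
  shows "pair_graph \<lparr>pverts = V, parcs = E\<rparr>"
proof
  show "finite (parcs \<lparr>pverts = V, parcs = E\<rparr>)"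
    using assms finite_subset by fastforce
qed (use assms in \<open>auto simp: symmetric_def irrefl_def\<close>)

lemma pair_graph_parent_graph:
  assumes "\<And>v. 0 < v \<Longrightarrow> p v < v"
  shows "pair_graph (parent_graph n p)"
  unfolding parent_graph_def
  by (rule pair_graphI) (auto simp: sym_def irrefl_def, metis assms less_irrefl)

lemma connected_parent_graph:
  assumes "\<And>v. 0 < v \<Longrightarrow> p v < v"
  shows "connected (with_proj (parent_graph n p))"
proof -
  let ?T = "parent_graph n p"
  interpret pair_graph ?T
    using assms by (rule pair_graph_parent_graph)
  have root: "v \<rightarrow>\<^sup>*\<^bsub>with_proj ?T\<^esub> 0" if "v \<le> n" for v
    using that
  proof (induction v rule: less_induct)
    case (less v)
    show ?case
    proof (cases "v = 0")
      case True
      have "0 \<in> pverts ?T"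
        by (simp add: parent_graph_def)
      then show ?thesis
        unfolding True by (rule reachable_refl)
    next
      case False
      then have "p v < v"
        using assms by simp
      then have "(v, p v) \<in> parcs ?T"
        using False less.prems by (simp add: parent_graph_def)
      moreover have "p v \<rightarrow>\<^sup>*\<^bsub>with_proj ?T\<^esub> 0"
        using \<open>p v < v\<close> less.prems by (intro less.IH) auto
      ultimately show ?thesis
        by (rule adj_reachable_trans)
    qed
  qed
  have "u \<rightarrow>\<^sup>*\<^bsub>with_proj ?T\<^esub> v" if "u \<le> n" "v \<le> n" for u v
    using root[OF that(1)] symmetric_reachable'[OF root[OF that(2)]] by (rule reachable_trans)
  \<comment> \<open>\<open>connected\<close> means strong connectedness of the symmetric
    closure.\<close>
  then have "u \<rightarrow>\<^sup>*\<^bsub>with_proj (mk_symmetric (with_proj ?T))\<^esub> v" if "u \<le> n" "v \<le> n" for u v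
    using that by (intro reachable_mk_symmetricI)
  then show ?thesis
    unfolding connected_def strongly_connected_def by (auto simp: parent_graph_def)
qed

text \<open>Positions replace the recursion along the walk, so that a cycle can be indexed modulo
  its length.\<close>

lemma pcas_nth:
  assumes "pcas u p v"
  shows "Suc i < length p \<Longrightarrow> fst (p ! Suc i) = snd (p ! i)"
    and "p \<noteq> [] \<Longrightarrow> fst (p ! 0) = u \<and> snd (p ! (length p - 1)) = v"
  using assms
proof (induction p arbitrary: u i)
  case (Cons e p)
  {
    case 1
    then show ?case
      using Cons.IH(1)[where u = "snd e"] Cons.IH(2)[where u = "snd e"]
      by (cases i; cases p) auto
  next
    case 2
    then show ?case
      using Cons.IH(2)[where u = "snd e"] by (cases p) auto
  }
qed auto

text \<open>
  The largest vertex of a cycle would be a child of both of its neighbours on the cycle.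
\<close>
lemma no_cycle_parent_graph:
  assumes less: "\<And>v. 0 < v \<Longrightarrow> p v < v"
    and cycle: "pre_digraph.cycle (with_proj (parent_graph n p)) c"
  shows "length c < 3"
proof (rule ccontr)
  assume "\<not> length c < 3"
  define m where "m = length c"
  have m: "3 \<le> m"
    using \<open>\<not> length c < 3\<close> by (simp add: m_def)
  interpret pair_graph "parent_graph n p"
    using less by (rule pair_graph_parent_graph)
  obtain u where u: "pcas u c u" "set c \<subseteq> parcs (parent_graph n p)"
    "distinct (tl (awalk_verts u c))" "c \<noteq> []"
    using cycle by (auto simp: cycle_def awalk_def)
  then have dist: "distinct (map snd c)"
    using awalk_verts_conv'[of u c u] by simp
  have consec: "fst (c ! (Suc i mod m)) = snd (c ! i)" if "i < m" for i
  proof (cases "Suc i = m")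
    case True
    then have "i = m - 1"
      by simp
    with True show ?thesis
      using pcas_nth(2)[OF u(1,4)] by (auto simp: m_def[symmetric])
  next
    case False
    then show ?thesis
      using pcas_nth(1)[OF u(1), of i] that by (simp add: m_def)
  qed
  have edge: "c ! i \<in> parcs (parent_graph n p)" if "i < m" for i
    using u(2) that by (auto simp: m_def)
  have "finite (set (map snd c))" "set (map snd c) \<noteq> {}"
    using u(4) by auto
  then have "Max (set (map snd c)) \<in> set (map snd c)" and
    "\<forall>x\<in>set (map snd c). x \<le> Max (set (map snd c))"
    by (auto simp del: set_map intro: Max_in)
  \<comment> \<open>The arc at position \<open>j'\<close> ends in the largest vertex of the
    cycle.\<close>
  then obtain j' where j': "j' < m" "\<And>i. i < m \<Longrightarrow> snd (c ! i) \<le> snd (c ! j')"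
    unfolding in_set_conv_nth m_def by (metis length_map nth_map nth_mem)
  \<comment> \<open>The positions \<open>i\<close> and \<open>k\<close> are the cyclic predecessor
    and successor of \<open>j'\<close>; adding \<open>m\<close> before subtracting 1 handles
    \<open>j' = 0\<close>.\<close>
  define i where "i = (j' + m - 1) mod m"
  have i: "i < m" "Suc i mod m = j'"
    using m j'(1) by (auto simp: i_def mod_Suc_eq)
  define k where "k = Suc j' mod m"
  have k: "k < m"
    using m by (simp add: k_def)
  let ?v = "snd (c ! j')"
  have parent: "b = p a"
    if "(a, b) \<in> parcs (parent_graph n p) \<or> (b, a) \<in> parcs (parent_graph n p)" "b \<le> a" for a b
    using that less[of b] by (auto simp: parent_graph_def)
  have "(snd (c ! i), ?v) \<in> parcs (parent_graph n p)"
    using edge[OF j'(1)] consec[OF i(1)] i(2) by (metis prod.collapse)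
  moreover have "(?v, snd (c ! k)) \<in> parcs (parent_graph n p)"
    using edge[OF k] consec[OF j'(1)] by (metis k_def prod.collapse)
  moreover have "snd (c ! i) \<le> ?v" "snd (c ! k) \<le> ?v"
    using j'(2) i(1) k by auto
  ultimately have "snd (c ! i) = p ?v" "snd (c ! k) = p ?v"
    using parent by blast+
  \<comment> \<open>Arcs of a cycle have distinct heads. But \<open>k\<close> is
    \<open>i + 2\<close> modulo \<open>m\<close>, which differs from \<open>i\<close> because
    \<open>m\<close> is at least 3.\<close>
  then have "i = k"
    using dist i(1) k by (metis distinct_conv_nth length_map m_def nth_map)
  moreover have "k = Suc (Suc i) mod m"
    using i(2) by (metis k_def mod_Suc_eq)
  ultimately show False
    using m i(1) by (auto simp: mod_if split: if_splits)
qed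

lemma undirected_tree_parent_graph:
  assumes "\<And>v. 0 < v \<Longrightarrow> p v < v"
  shows "undirected_tree (parent_graph n p)"
  unfolding undirected_tree_def
  using pair_graph_parent_graph[OF assms] connected_parent_graph[OF assms]
    no_cycle_parent_graph[OF assms] by (meson not_le)

section \<open>The spider and its supergraph\<close>

text \<open>
  The hub is \<open>0\<close>; the vertices \<open>o, a, b, c, d, w\<close> of leg \<open>i < k\<close> are \<open>6 * i + 1, \<dots>, 6 * i + 6\<close>.
\<close>
definition spider :: "nat \<Rightarrow> nat pair_pre_digraph" where
  "spider k = parent_graph (6 * k) (\<lambda>v. if v mod 6 \<le> 1 then 0 else v - 1)"

text \<open>Vertices \<open>b\<close> have residue 3 modulo 6, and the leaf \<open>w\<close> of the
  same leg is \<open>b + 3\<close>.\<close>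

definition chorded_spider :: "nat \<Rightarrow> nat pair_pre_digraph" where
  "chorded_spider k = \<lparr>pverts = {..6 * k}, parcs = parcs (spider k) \<union>
     {(u, v). u \<le> 6 * k \<and> v \<le> 6 * k \<and> (u mod 6 = 3 \<and> v = u + 3 \<or> v mod 6 = 3 \<and> u = v + 3)}\<rparr>"

lemma pverts_spider [simp]: "pverts (spider k) = {..6 * k}"
  by (simp add: spider_def parent_graph_def)

lemma pverts_chorded_spider [simp]: "pverts (chorded_spider k) = {..6 * k}"
  by (simp add: chorded_spider_def)

lemma parcs_spider:
  "(u, v) \<in> parcs (spider k) \<longleftrightarrow> u \<le> 6 * k \<and> v \<le> 6 * k \<and>
     (0 < u \<and> u mod 6 \<le> 1 \<and> v = 0 \<or> 0 < v \<and> v mod 6 \<le> 1 \<and> u = 0 \<or>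
      2 \<le> u mod 6 \<and> u = Suc v \<or> 2 \<le> v mod 6 \<and> v = Suc u)"
  by (auto simp: spider_def parent_graph_def gr0_conv_Suc split: if_splits)

lemma parcs_chorded_spider:
  "(u, v) \<in> parcs (chorded_spider k) \<longleftrightarrow> u \<le> 6 * k \<and> v \<le> 6 * k \<and>
     ((u, v) \<in> parcs (spider k) \<or> u mod 6 = 3 \<and> v = u + 3 \<or> v mod 6 = 3 \<and> u = v + 3)"
  by (auto simp: chorded_spider_def parcs_spider)

lemma pair_graph_chorded_spider: "pair_graph (chorded_spider k)"
  unfolding chorded_spider_def
  by (rule pair_graphI) (auto simp: parcs_spider sym_def irrefl_def)

lemma undirected_spanning_tree_spider:
  "undirected_spanning_tree (spider k) (chorded_spider k)"
proof -
  have tree: "undirected_tree (spider k)"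
    unfolding spider_def by (rule undirected_tree_parent_graph) simp
  then have "pair_graph (spider k)"
    by (simp add: undirected_tree_def)
  then interpret T: pair_graph "spider k" .
  interpret G: pair_graph "chorded_spider k"
    by (rule pair_graph_chorded_spider)
  have "subgraph (with_proj (spider k)) (with_proj (chorded_spider k))"
    unfolding subgraph_def compatible_def using T.wf_digraph G.wf_digraph
    by (auto simp: chorded_spider_def)
  then show ?thesis
    using tree by (simp add: undirected_spanning_tree_def spanning_def)
qed

section \<open>Upper bound on the spider\<close>

lemma closed_nbhd_spider:
  "2 \<le> x mod 6 \<Longrightarrow> x \<in> closed_nbhd (spider k) v \<longleftrightarrow>
    x = v \<or> x \<le> 6 * k \<and> v \<le> 6 * k \<and> (x = Suc v \<or> v = Suc x \<and> 2 \<le> v mod 6)"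
  by (auto simp: closed_nbhd_def parcs_spider)

text \<open>Residues 2 to 5 are the vertices \<open>a, b, c, d\<close>. Their neighbours are
  consecutive numbers in the same block of six; \<open>d\<close> is not adjacent to the next number,
  the leaf \<open>w\<close>.\<close>

lemma closed_nbhd_spider_leg:
  assumes "2 \<le> x mod 6" "x \<in> closed_nbhd (spider k) v"
  shows "v div 6 = x div 6" "1 \<le> v mod 6"
proof -
  have "x = v \<or> x = Suc v \<or> v = Suc x \<and> 2 \<le> v mod 6"
    using assms by (auto simp: closed_nbhd_spider)
  then show "v div 6 = x div 6" "1 \<le> v mod 6"
    using assms(1) by (auto simp: mod_Suc div_Suc split: if_splits)
qed

lemma spider_le: "game_domination_number (spider k) \<le> 2 * k + 1"
proof -
  let ?T = "spider k"
  \<comment> \<open>The path \<open>a - b - c - d\<close> of leg \<open>i\<close>, which the hub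
    leaves undominated.\<close>
  let ?C = "\<lambda>i. {x. x div 6 = i \<and> 2 \<le> x mod 6}"
  have "game_value ?T Staller {0} \<le> 2 * card {..<k}"
  proof (rule game_value_le_paired_replies[where C = ?C])
    have "x div 6 < k" if "x \<le> 6 * k" "\<not> x mod 6 \<le> Suc 0" for x
      using that div_mult_mod_eq[of x 6] by linarith
    moreover have "x \<le> 6 * k" if "x div 6 < k" for x
      using that div_mult_mod_eq[of x 6] mod_less_divisor[of 6 x] by linarith
    ultimately show "pverts ?T - dominated ?T {0} = (\<Union>i<k. ?C i)"
      by (auto simp: dominated_def closed_nbhd_def parcs_spider, blast)
  next
    fix v assume "v \<in> pverts ?T"
    then show "closed_nbhd ?T v \<subseteq> pverts ?T"
      by (auto simp: closed_nbhd_def parcs_spider)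
  next
    fix v x y i j assume "x \<in> closed_nbhd ?T v \<inter> ?C i" "y \<in> closed_nbhd ?T v \<inter> ?C j"
    then show "i = j"
      using closed_nbhd_spider_leg(1)[of x k v] closed_nbhd_spider_leg(1)[of y k v] by auto
  next
    fix v i assume "i \<in> {..<k}" "v \<in> pverts ?T" and hit: "closed_nbhd ?T v \<inter> ?C i \<noteq> {}"
    then have i: "6 * i + 6 \<le> 6 * k"
      by simp
    have C: "?C i = {6 * i + 2, 6 * i + 3, 6 * i + 4, 6 * i + 5}"
      by auto presburger+
    have "v div 6 = i" "1 \<le> v mod 6"
      using hit closed_nbhd_spider_leg by auto
    then obtain n where "v = 6 * i + n" "1 \<le> n" "n < 6"
      using div_mult_mod_eq[of v 6] mod_less_divisor[of 6 v] by (metis mult.commute zero_less_numeral)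
    then have "v \<in> {6 * i + 1, 6 * i + 2, 6 * i + 3, 6 * i + 4, 6 * i + 5}"
      by auto
    \<comment> \<open>A move at \<open>o\<close>, \<open>a\<close> or \<open>b\<close> dominates
      \<open>a\<close> but not \<open>d\<close>, and the reply \<open>c\<close> dominates
      \<open>b, c, d\<close>. A move at \<open>c\<close> or \<open>d\<close> dominates
      \<open>d\<close> but not \<open>a\<close>, and the reply \<open>b\<close> dominates
      \<open>a, b, c\<close>.\<close>
    then show "\<exists>r\<in>pverts ?T. ?C i \<subseteq> closed_nbhd ?T v \<union> closed_nbhd ?T r \<and>
        \<not> ?C i \<subseteq> closed_nbhd ?T v"
      unfolding C using i
      by (intro bexI[of _ "if v \<le> 6 * i + 3 then 6 * i + 4 else 6 * i + 3"])
        (auto simp: closed_nbhd_def parcs_spider mod_Suc)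
  qed simp_all
  moreover have "0 \<in> legal_moves ?T {}"
    by (auto simp: legal_moves_def closed_nbhd_def dominated_def)
  ultimately show ?thesis
    using game_value_Dominator_le[of ?T 0 "{}"] by (simp add: game_domination_number_def)
qed

section \<open>Lower bound on the chorded spider\<close>

lemma closed_nbhd_chorded_spider:
  assumes "2 \<le> x mod 6" "x \<in> closed_nbhd (chorded_spider k) v"
  shows "x = v \<or> x = Suc v \<or> v = Suc x \<and> 2 \<le> v mod 6 \<or> x mod 6 = 3 \<and> v = x + 3"
  using assms by (auto simp: closed_nbhd_def parcs_chorded_spider parcs_spider, presburger+)

lemma chorded_spider_ge: "2 * k + k div 2 \<le> game_domination_number (chorded_spider k)"
proof -
  let ?G = "chorded_spider k"
  \<comment> \<open>\<open>?X\<close> consists of all \<open>a\<close> and \<open>d\<close>, and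
    \<open>?B\<close> of all \<open>b\<close>.\<close>
  let ?X = "(\<lambda>i. 6 * i + 2) ` {..<k} \<union> (\<lambda>i. 6 * i + 5) ` {..<k}"
  let ?B = "(\<lambda>i. 6 * i + 3) ` {..<k}"
  have X: "x mod 6 = 2 \<or> x mod 6 = 5" if "x \<in> ?X" for x
    using that by (auto, presburger)
  have B: "x mod 6 = 3" if "x \<in> ?B" for x
    using that by auto
  have "card (?X - dominated ?G {}) + (card (?B - dominated ?G {}) +
      (if Dominator = Staller then 1 else 0)) div 2 \<le> game_value ?G Dominator {}"
  proof (rule game_value_ge_packing)
    fix v
    \<comment> \<open>The right-hand side depends on \<open>v\<close> alone, so \<open>v\<close>
      dominates at most one vertex of \<open>?X\<close>.\<close>
    have "x = 6 * (v div 6) + (if v mod 6 \<le> 3 then 2 else 5)"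
      if x: "x \<in> ?X" "x \<in> closed_nbhd ?G v" for x
    proof -
      have "2 \<le> x mod 6" "x mod 6 \<noteq> 3"
        using X[OF x(1)] by linarith+
      then have "x = v \<or> x = Suc v \<or> v = Suc x \<and> 2 \<le> v mod 6"
        using closed_nbhd_chorded_spider[OF _ x(2)] by simp
      with x(1) show ?thesis
        by (auto simp: mod_Suc div_Suc split: if_splits)
    qed
    then have "x = y" if "x \<in> ?X \<inter> closed_nbhd ?G v" "y \<in> ?X \<inter> closed_nbhd ?G v" for x y
      using that by (metis IntD1 IntD2)
    moreover have "finite (?X \<inter> closed_nbhd ?G v)"
      by simp
    ultimately show "card (?X \<inter> closed_nbhd ?G v) \<le> 1"
      unfolding One_nat_def by (subst card_le_Suc0_iff_eq) (assumption, intro ballI)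
    \<comment> \<open>Again a function of \<open>v\<close>; residue 0 is the case where
      \<open>v\<close> is a leaf \<open>w\<close>, reaching \<open>b\<close> through the
      chord.\<close>
    have "x = (if v mod 6 = 0 then v - 3 else 6 * (v div 6) + 3)"
      if x: "x \<in> ?B" "x \<in> closed_nbhd ?G v" for x
    proof -
      have "x = v \<or> x = Suc v \<or> v = Suc x \<or> v = x + 3"
        using closed_nbhd_chorded_spider[OF _ x(2)] B[OF x(1)] by auto
      with x(1) show ?thesis
        by (auto simp: mod_Suc div_Suc split: if_splits, presburger+)
    qed
    then have "x = y" if "x \<in> ?B \<inter> closed_nbhd ?G v" "y \<in> ?B \<inter> closed_nbhd ?G v" for x y
      using that by (metis IntD1 IntD2)
    moreover have "finite (?B \<inter> closed_nbhd ?G v)"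
      by simp
    ultimately show "card (?B \<inter> closed_nbhd ?G v) \<le> 1"
      unfolding One_nat_def by (subst card_le_Suc0_iff_eq) (assumption, intro ballI)
  next
    fix b assume "b \<in> ?B"
    then obtain i where i: "i < k" "b = 6 * i + 3"
      by auto
    \<comment> \<open>The wasted move is the leaf \<open>w\<close> of the same leg.\<close>
    have "x \<notin> closed_nbhd ?G (6 * i + 6)" if "x \<in> ?X" for x
    proof
      assume x: "x \<in> closed_nbhd ?G (6 * i + 6)"
      have "2 \<le> x mod 6" "x mod 6 \<noteq> 3"
        using X[OF that] by linarith+
      moreover have "(6 * i + 6) mod 6 = 0" "Suc (6 * i + 6) mod 6 = 1"
        by (simp_all add: mod_Suc)
      ultimately show False
        using closed_nbhd_chorded_spider[OF _ x] by auto
    qed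
    then have "?X \<inter> closed_nbhd ?G (6 * i + 6) = {}"
      by blast
    moreover have "b \<in> closed_nbhd ?G (6 * i + 6)"
      using i by (auto simp: closed_nbhd_def parcs_chorded_spider)
    ultimately show "\<exists>w\<in>pverts ?G. b \<in> closed_nbhd ?G w \<and> ?X \<inter> closed_nbhd ?G w = {}"
      using i by (intro bexI[of _ "6 * i + 6"]) auto
  qed auto
  moreover have "card ?X = k + k"
    by (subst card_Un_disjoint) (auto simp: card_image inj_on_def, presburger)
  moreover have "card ?B = k"
    by (simp add: card_image inj_on_def)
  ultimately show ?thesis
    by (simp add: game_domination_number_def dominated_def)
qed

theorem theorem4p5:
  fixes l :: nat
  assumes "l \<ge> 1"
  shows "\<exists>(G :: nat pair_pre_digraph) T.
    pair_graph G \<and> pverts G \<noteq> {} \<and> undirected_spanning_tree T G \<and>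
    int (game_domination_number G) - int (game_domination_number T) \<ge> int l"
proof (intro exI conjI)
  \<comment> \<open>With this \<open>?k\<close> the bounds differ by
    \<open>?k div 2 - 1 = l\<close>.\<close>
  let ?k = "2 * l + 2"
  show "pair_graph (chorded_spider ?k)" "undirected_spanning_tree (spider ?k) (chorded_spider ?k)"
    by (rule pair_graph_chorded_spider undirected_spanning_tree_spider)+
  show "pverts (chorded_spider ?k) \<noteq> {}"
    by auto
  show "int l \<le> int (game_domination_number (chorded_spider ?k)) -
      int (game_domination_number (spider ?k))"
    using chorded_spider_ge[of ?k] spider_le[of ?k] by simp
qed

end
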